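(* Suppose Assumptions (A2) and (A3) below hold and $x$ is such that $\mathtt{P}_{N_p}^{\mathrm{G}}(x)$ has a feasible solution for the tubes $\mathsf{Z}_k^j=\{z\mid Tz\leq \tau_k^j\}$, $(j,k)\in I_{N_r:N_p-1}$. Then $\mathtt{P}_{N_p}^{\mathrm{G}}(x^+)$ is feasible for all $x^+\in \mathrm{conv}(\{A_i x+B_i u\})\oplus\mathsf W,\,\forall i\in\Gamma_p$, if the control input applied to the system follows the control policy $u=v+K_{\mathrm{inv}}(x-z)$.
   Context: Consider the uncertain linear system $x^+=Ax+Bu+w$ with $(A,B)\in\mathrm{conv}(\{(A_i,B_i),\,i\in\Gamma_p\})$, $\Gamma_p=\{1,\dots,n_p\}$, $w\in\mathsf W$ (convex polytope containing the origin in its interior), polytopic constraints $x\in\mathbb X$, $u\in\mathbb U$. The disturbance set is split as $\mathsf W\subseteq\overline{\mathsf W}\oplus\underline{\mathsf W}$ with $\overline{\mathsf W}=\mathrm{conv}\{w_l,\,l\in\Gamma_{\overline w}\}$ (large) and $\underline{\mathsf W}$ (small). Nominal model $z^+=A_iz+B_iv+w$, $w\in\overline{\mathsf W}$; control $u=v+K_{\mathrm{inv}}(x-z)$; $\mathsf S$ satisfies $(A_i+B_iK_{\mathrm{inv}})\mathsf S\oplus\underline{\mathsf W}\subseteq\mathsf S$; tightened sets $\mathbb Z=\mathbb X\ominus\mathsf S=\{z\mid Fz\le\mathbf 1\}$, $\mathbb V=\mathbb U\ominus K_{\mathrm{inv}}\mathsf S=\{v\mid Gv\le\mathbf 1\}$.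 The tube-enhanced multi-stage MPC problem uses a scenario tree with nodes $z_k^j$ and inputs $v_k^j$ ($I_{k_1:k_2}$ = tree indices at stages $k_1,\dots,k_2$), branching $z_{k+1}^c=A_iz_k^j+B_iv_k^j+w_l$ for all $i,l$ up to the robust horizon $N_r$ with $z_k^j\in\mathbb Z$, $v_k^j\in\mathbb V$, root constraint $x\in\{z_0^1\}\oplus\mathsf S$, and beyond $N_r$ tubes under the policy $v_k^j+K_{\mathrm{pred}}z$. $\mathtt{P}^{\mathrm G}_{N_p}(x)$ is its convex "general complexity tube" implementation: tubes $\mathsf Z_k^j=\{z\mid Tz\le\tau_k^j\}$ with fixed $T$ (such that $\{z\mid Tz\le\mathbf 1\}$ is $\lambda$-contractive) and decision variables $\tau_k^j$; the set inclusions are replaced via Farkas' lemma (for nonempty polytopes, $\{x\mid T_1x\le\tau_1\}\subseteq\{x\mid T_2x\le\tau_2\}$ iff there is a nonnegative $P$ with $PT_1=T_2$, $P\tau_1\le\tau_2$) using nonnegative matrices computed offline with $P_iT=T(A_i+B_iK_{\mathrm{pred}})$, $P_xT=F$, $P_uT=GK_{\mathrm{pred}}$, $P_QT=Q$, giving linear constraints $P_i\tau_k^j+TB_iv_k^j+Tw_l\le\tau_{k+1}^j$, $P_x\tau_k^j\le\mathbf 1$, $Gv_k^j+P_u\tau_k^j\le\mathbf 1$, terminal $P_i\tau_{N_p}^j+Tw_l\le\tau_{N_p}^j$, $Tz_{N_r}^j\le\tau_{N_r}^j$; the worst-case tube stage cost is upper bounded by slack variables $\gamma_k^j$ ($-\mu\le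 P_Q\tau_k^j-Qy_k^j\le\mu$ with $y_k^j\in\mathbb Z_f$, $-\eta\le Rv_k^j\le\eta$, $\mathbf 1^T\mu+\mathbf 1^T\eta\le\gamma_k^j$). (A2) $\mathsf S$ is a convex compact disturbance invariant polytope with $\mathsf S\subset\mathbb X$, $K_{\mathrm{inv}}\mathsf S\subset\mathbb U$ ($\mathsf S=\{0\}$ if $\underline{\mathsf W}=\{0\}$). (A3) $\mathbb Z_f\subseteq\mathbb X\ominus\mathsf S$ is a robust positively invariant polytope containing the origin for the nominal model with $K_f=K_{\mathrm{pred}}$, $K_f\mathbb Z_f\subseteq\mathbb U\ominus K_{\mathrm{inv}}\mathsf S$, and for all tubes $\mathsf Z\subseteq\mathbb Z_f$, $(A_i+B_iK_f)\mathsf Z\oplus\overline{\mathsf W}\subseteq\mathsf Z^+\subseteq\mathbb Z_f$ for all $i$. *)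

theory Defs
  imports "HOL-Analysis.Analysis"
begin

text \<open>Minkowski sum and Pontryagin difference of sets.\<close>
definition msum :: "'a::plus set \<Rightarrow> 'a set \<Rightarrow> 'a set" where
  "msum A B = {a + b | a b. a \<in> A \<and> b \<in> B}"

definition pdiff :: "'a::plus set \<Rightarrow> 'a set \<Rightarrow> 'a set" where
  "pdiff A B = {x. \<forall>b\<in>B. x + b \<in> A}"

text \<open>Entrywise nonnegative matrix.\<close>
definition nonneg_mat :: "real^'c^'r \<Rightarrow> bool" where
  "nonneg_mat P \<longleftrightarrow> (\<forall>a b. 0 \<le> P $ a $ b)"

text \<open>Tube (polytope with fixed shape matrix T) {z | T z <= tau}.\<close>
definition tube :: "real^'n^'q \<Rightarrow> real^'q \<Rightarrow> (real^'n) set" where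
  "tube T tau = {z. T *v z \<le> tau}"

text \<open>Nodes of the scenario tree at stage k (k <= N_r): the sequence of branch labels
  (i,l) (model index i in {1..np}, disturbance vertex index l in {1..nw}) leading from
  the root to the node. The root is the empty list.\<close>
definition scen_paths :: "nat \<Rightarrow> nat \<Rightarrow> nat \<Rightarrow> (nat \<times> nat) list set" where
  "scen_paths np nw k = {p. length p = k \<and> set p \<subseteq> {1..np} \<times> {1..nw}}"

text \<open>(z, v, tau, vt) is a feasible solution of the general complexity tube-enhanced
  multi-stage MPC problem P^G_{Np}(x).
  z p  : nominal node of the tree (length p <= Nr), v p : its input (length p < Nr);
  for every leaf path p (length Nr) and Nr <= k <= Np: tau p k the tube parameter,
  and for Nr <= k < Np: vt p k the tube input (policy vt p k + Kpred z).\<close>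
definition mpcG_solution ::
  "nat \<Rightarrow> nat \<Rightarrow> (nat \<Rightarrow> real^'n^'n) \<Rightarrow> (nat \<Rightarrow> real^'m^'n) \<Rightarrow> (nat \<Rightarrow> real^'n)
   \<Rightarrow> nat \<Rightarrow> nat \<Rightarrow> real^'n^'q \<Rightarrow> real^'n^'f \<Rightarrow> real^'m^'g \<Rightarrow> (real^'n) set
   \<Rightarrow> (nat \<Rightarrow> real^'q^'q) \<Rightarrow> real^'q^'f \<Rightarrow> real^'q^'g \<Rightarrow> real^'q^'r \<Rightarrow> real^'n^'r
   \<Rightarrow> real^'m^'s \<Rightarrow> (real^'n) set \<Rightarrow> real^'n
   \<Rightarrow> ((nat \<times> nat) list \<Rightarrow> real^'n) \<Rightarrow> ((nat \<times> nat) list \<Rightarrow> real^'m)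
   \<Rightarrow> ((nat \<times> nat) list \<Rightarrow> nat \<Rightarrow> real^'q) \<Rightarrow> ((nat \<times> nat) list \<Rightarrow> nat \<Rightarrow> real^'m) \<Rightarrow> bool"
where
  "mpcG_solution np nw A B wv Nr Np T F G S Pm Px Pu PQ Q R Zf x z v tau vt \<longleftrightarrow>
     x \<in> msum {z []} S \<and>
     (\<forall>k<Nr. \<forall>p\<in>scen_paths np nw k.
        F *v z p \<le> 1 \<and> G *v v p \<le> 1 \<and>
        (\<forall>i\<in>{1..np}. \<forall>l\<in>{1..nw}. z (p @ [(i,l)]) = A i *v z p + B i *v v p + wv l)) \<and>
     (\<forall>p\<in>scen_paths np nw Nr.
        T *v z p \<le> tau p Nr \<and>
        (\<forall>k\<in>{Nr..<Np}.
           (\<forall>i\<in>{1..np}. \<forall>l\<in>{1..nw}.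
               Pm i *v tau p k + T *v (B i *v vt p k) + T *v wv l \<le> tau p (Suc k)) \<and>
           Px *v tau p k \<le> 1 \<and>
           G *v vt p k + Pu *v tau p k \<le> 1 \<and>
           (\<exists>y\<in>Zf. \<exists>(mu::real^'r) (eta::real^'s) (gamma::real).
               - mu \<le> PQ *v tau p k - Q *v y \<and> PQ *v tau p k - Q *v y \<le> mu \<and>
               - eta \<le> R *v vt p k \<and> R *v vt p k \<le> eta \<and>
               (\<Sum>a\<in>UNIV. mu $ a) + (\<Sum>b\<in>UNIV. eta $ b) \<le> gamma)) \<and>
        (\<forall>i\<in>{1..np}. \<forall>l\<in>{1..nw}. Pm i *v tau p Np + T *v wv l \<le> tau p Np) \<and>
        Px *v tau p Np \<le> 1 \<and> Pu *v tau p Np \<le> 1)"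

definition mpcG_feasible ::
  "nat \<Rightarrow> nat \<Rightarrow> (nat \<Rightarrow> real^'n^'n) \<Rightarrow> (nat \<Rightarrow> real^'m^'n) \<Rightarrow> (nat \<Rightarrow> real^'n)
   \<Rightarrow> nat \<Rightarrow> nat \<Rightarrow> real^'n^'q \<Rightarrow> real^'n^'f \<Rightarrow> real^'m^'g \<Rightarrow> (real^'n) set
   \<Rightarrow> (nat \<Rightarrow> real^'q^'q) \<Rightarrow> real^'q^'f \<Rightarrow> real^'q^'g \<Rightarrow> real^'q^'r \<Rightarrow> real^'n^'r
   \<Rightarrow> real^'m^'s \<Rightarrow> (real^'n) set \<Rightarrow> real^'n \<Rightarrow> bool"
where
  "mpcG_feasible np nw A B wv Nr Np T F G S Pm Px Pu PQ Q R Zf x \<longleftrightarrow>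
     (\<exists>z v tau vt. mpcG_solution np nw A B wv Nr Np T F G S Pm Px Pu PQ Q R Zf x z v tau vt)"

end

theory Submission
  imports Defs
begin

(*
  Two facts combine. First, the feasible set of P^G_Np is convex: every constraint is affine
  in the decision variables, the root constraint x \<in> {z_0} \<oplus> S only needs S convex, and the
  slack constraints bounding the stage cost can always be met. Second, for every model i,
  every vertex w_l of the large disturbance set and every small disturbance w, the successor
  A_i x + B_i u + w_l + w is feasible: the subtree below the root branch (i, l), moved up by one
  stage, is a solution. Its leaves continue with the tube policy v + K_pred z, and the Farkas
  certificates P_i T = T (A_i + B_i K_pred) carry each tube one stage forward, the terminal tube
  being invariant. Every admissible x+ lies in the convex hull of such successors.
*)

lemma msum_eq_set_plus: "msum A B = A + B"
  by (auto simp: msum_def set_plus_def)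

lemma nonneg_mat_mono:
  assumes "nonneg_mat P" "a \<le> b"
  shows "P *v a \<le> P *v b"
  using assms
  by (auto simp: less_eq_vec_def matrix_vector_mult_def nonneg_mat_def intro!: sum_mono mult_left_mono)

lemma nonneg_mat_factor_le:
  assumes "nonneg_mat P" "P ** T = M" "T *v y \<le> t"
  shows "M *v y \<le> P *v t"
  using nonneg_mat_mono[OF assms(1,3)] assms(2) by (simp add: matrix_vector_mul_assoc)

lemma convex_comb_le:
  fixes a b c d :: "'a::ordered_real_vector"
  assumes "a \<le> c" "b \<le> d" "0 \<le> u" "u \<le> 1"
  shows "u *\<^sub>R a + (1 - u) *\<^sub>R b \<le> u *\<^sub>R c + (1 - u) *\<^sub>R d"
  using assms by (intro add_mono scaleR_left_mono) auto

lemma convex_comb_le_const: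
  fixes a b c :: "'a::ordered_real_vector"
  assumes "a \<le> c" "b \<le> c" "0 \<le> u" "u \<le> 1"
  shows "u *\<^sub>R a + (1 - u) *\<^sub>R b \<le> c"
  using convex_comb_le[OF assms] by (simp flip: scaleR_left_distrib)

lemma convex_comb_le_affine:
  fixes a1 a2 b1 b2 c :: "'a::ordered_real_vector"
  assumes "a1 + c \<le> b1" "a2 + c \<le> b2" "0 \<le> u" "u \<le> 1"
  shows "(u *\<^sub>R a1 + (1 - u) *\<^sub>R a2) + c \<le> u *\<^sub>R b1 + (1 - u) *\<^sub>R b2"
  using convex_comb_le[OF assms] by (simp add: algebra_simps)

lemma convex_comb_add:
  fixes a1 a2 b1 b2 :: "'a::real_vector"
  shows "(u *\<^sub>R a1 + (1 - u) *\<^sub>R a2) + (u *\<^sub>R b1 + (1 - u) *\<^sub>R b2)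
           = u *\<^sub>R (a1 + b1) + (1 - u) *\<^sub>R (a2 + b2)"
  by (simp add: algebra_simps)

lemma convex_comb_add_const:
  fixes a1 a2 c :: "'a::real_vector"
  shows "u *\<^sub>R (a1 + c) + (1 - u) *\<^sub>R (a2 + c) = (u *\<^sub>R a1 + (1 - u) *\<^sub>R a2) + c"
  by (simp add: algebra_simps)

lemma stage_cost_slack_exists:
  fixes PQ :: "real^'q^'r" and Q :: "real^'n^'r" and R :: "real^'m^'s"
  assumes "y \<in> Zf"
  shows "\<exists>y\<in>Zf. \<exists>(mu::real^'r) (eta::real^'s) (gamma::real).
           - mu \<le> PQ *v t - Q *v y \<and> PQ *v t - Q *v y \<le> mu \<and>
           - eta \<le> R *v vv \<and> R *v vv \<le> eta \<and>
           (\<Sum>a\<in>UNIV. mu $ a) + (\<Sum>b\<in>UNIV. eta $ b) \<le> gamma"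
  using assms
  by (intro bexI[of _ y] exI[of _ "\<chi> a. \<bar>(PQ *v t - Q *v y) $ a\<bar>"]
        exI[of _ "\<chi> a. \<bar>(R *v vv) $ a\<bar>"])
     (auto simp: less_eq_vec_def)

locale tube_mpc_data =
  fixes np nw :: nat
    and A :: "nat \<Rightarrow> real^'n^'n" and B :: "nat \<Rightarrow> real^'m^'n" and wv :: "nat \<Rightarrow> real^'n"
    and Nr Np :: nat
    and T :: "real^'n^'q" and F :: "real^'n^'f" and G :: "real^'m^'g" and S :: "(real^'n) set"
    and Pm :: "nat \<Rightarrow> real^'q^'q" and Px :: "real^'q^'f" and Pu :: "real^'q^'g"
    and PQ :: "real^'q^'r" and Q :: "real^'n^'r" and R :: "real^'m^'s" and Zf :: "(real^'n) set"
    and Kpred :: "real^'n^'m"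
begin

abbreviation "is_solution \<equiv> mpcG_solution np nw A B wv Nr Np T F G S Pm Px Pu PQ Q R Zf"
abbreviation "feasible \<equiv> mpcG_feasible np nw A B wv Nr Np T F G S Pm Px Pu PQ Q R Zf"

definition tree_feasible ::
    "((nat \<times> nat) list \<Rightarrow> real^'n) \<Rightarrow> ((nat \<times> nat) list \<Rightarrow> real^'m) \<Rightarrow> bool"
  where "tree_feasible z v \<longleftrightarrow>
    (\<forall>k<Nr. \<forall>p\<in>scen_paths np nw k. F *v z p \<le> 1 \<and> G *v v p \<le> 1 \<and>
       (\<forall>i\<in>{1..np}. \<forall>l\<in>{1..nw}. z (p @ [(i,l)]) = A i *v z p + B i *v v p + wv l))"

(* The constraints on the tube parameters t k and tube inputs w k, Nr \<le> k \<le> Np, attached to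
   one leaf node zN of the scenario tree, without the stage-cost slack constraints. *)
definition tube_feasible :: "real^'n \<Rightarrow> (nat \<Rightarrow> real^'q) \<Rightarrow> (nat \<Rightarrow> real^'m) \<Rightarrow> bool"
  where "tube_feasible zN t w \<longleftrightarrow>
    T *v zN \<le> t Nr \<and>
    (\<forall>k\<in>{Nr..<Np}.
       (\<forall>i\<in>{1..np}. \<forall>l\<in>{1..nw}. Pm i *v t k + T *v (B i *v w k) + T *v wv l \<le> t (Suc k)) \<and>
       Px *v t k \<le> 1 \<and> G *v w k + Pu *v t k \<le> 1) \<and>
    (\<forall>i\<in>{1..np}. \<forall>l\<in>{1..nw}. Pm i *v t Np + T *v wv l \<le> t Np) \<and>
    Px *v t Np \<le> 1 \<and> Pu *v t Np \<le> 1"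

lemma is_solution_iff:
  assumes "y \<in> Zf"
  shows "is_solution x z v tau vt \<longleftrightarrow>
    x \<in> msum {z []} S \<and> tree_feasible z v \<and>
    (\<forall>p\<in>scen_paths np nw Nr. tube_feasible (z p) (tau p) (vt p))"
  using stage_cost_slack_exists[OF assms]
  unfolding mpcG_solution_def tree_feasible_def tube_feasible_def by blast

lemma tree_feasible_convex_comb:
  assumes "tree_feasible z1 v1" "tree_feasible z2 v2" "0 \<le> u" "u \<le> 1"
  shows "tree_feasible (\<lambda>p. u *\<^sub>R z1 p + (1 - u) *\<^sub>R z2 p) (\<lambda>p. u *\<^sub>R v1 p + (1 - u) *\<^sub>R v2 p)"
  using assms(1,2) unfolding tree_feasible_def
  by (auto simp: matrix_vector_right_distrib matrix_vector_mult_scaleR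
                 convex_comb_add convex_comb_add_const
           intro!: convex_comb_le_const[where c = 1, OF _ _ assms(3,4)])

lemma tube_feasible_convex_comb:
  assumes "tube_feasible zN1 t1 w1" "tube_feasible zN2 t2 w2" "0 \<le> u" "u \<le> 1"
  shows "tube_feasible (u *\<^sub>R zN1 + (1 - u) *\<^sub>R zN2)
           (\<lambda>k. u *\<^sub>R t1 k + (1 - u) *\<^sub>R t2 k) (\<lambda>k. u *\<^sub>R w1 k + (1 - u) *\<^sub>R w2 k)"
  using assms(1,2) unfolding tube_feasible_def
  by (auto simp: matrix_vector_right_distrib matrix_vector_mult_scaleR convex_comb_add
           intro!: convex_comb_le[OF _ _ assms(3,4)] convex_comb_le_affine[OF _ _ assms(3,4)]
                   convex_comb_le_const[where c = 1, OF _ _ assms(3,4)])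

lemma convex_feasible_set:
  assumes "convex S" "y \<in> Zf"
  shows "convex {x. feasible x}"
proof (rule convexI)
  fix x1 x2 and u u' :: real assume x: "x1 \<in> {x. feasible x}" "x2 \<in> {x. feasible x}"
    and u: "0 \<le> u" "0 \<le> u'" "u + u' = 1"
  obtain z1 v1 tau1 vt1 z2 v2 tau2 vt2 where
    sol1: "is_solution x1 z1 v1 tau1 vt1" and sol2: "is_solution x2 z2 v2 tau2 vt2"
    using x by (auto simp: mpcG_feasible_def)
  have u1: "0 \<le> u" "u \<le> 1" and u': "u' = 1 - u" using u by auto
  note sol_iff = is_solution_iff[OF \<open>y \<in> Zf\<close>]
  have "u *\<^sub>R x1 + (1 - u) *\<^sub>R x2 \<in> msum {u *\<^sub>R z1 [] + (1 - u) *\<^sub>R z2 []} S"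
  proof -
    obtain s1 s2 where s: "s1 \<in> S" "s2 \<in> S" "x1 = z1 [] + s1" "x2 = z2 [] + s2"
      using sol1 sol2 by (auto simp: mpcG_solution_def msum_def)
    have "u *\<^sub>R s1 + (1 - u) *\<^sub>R s2 \<in> S"
      using \<open>convex S\<close> s u1 by (simp add: convex_def)
    moreover have "u *\<^sub>R x1 + (1 - u) *\<^sub>R x2
        = (u *\<^sub>R z1 [] + (1 - u) *\<^sub>R z2 []) + (u *\<^sub>R s1 + (1 - u) *\<^sub>R s2)"
      using s by (simp add: algebra_simps)
    ultimately show ?thesis
      unfolding msum_def by blast
  qed
  moreover have "tree_feasible (\<lambda>p. u *\<^sub>R z1 p + (1 - u) *\<^sub>R z2 p) (\<lambda>p. u *\<^sub>R v1 p + (1 - u) *\<^sub>R v2 p)"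
    using sol1 sol2 tree_feasible_convex_comb[OF _ _ u1] unfolding sol_iff by blast
  moreover have "tube_feasible (u *\<^sub>R z1 p + (1 - u) *\<^sub>R z2 p)
      (\<lambda>k. u *\<^sub>R tau1 p k + (1 - u) *\<^sub>R tau2 p k) (\<lambda>k. u *\<^sub>R vt1 p k + (1 - u) *\<^sub>R vt2 p k)"
    if "p \<in> scen_paths np nw Nr" for p
    using sol1 sol2 tube_feasible_convex_comb[OF _ _ u1] that unfolding sol_iff by blast
  ultimately have "is_solution (u *\<^sub>R x1 + (1 - u) *\<^sub>R x2)
      (\<lambda>p. u *\<^sub>R z1 p + (1 - u) *\<^sub>R z2 p) (\<lambda>p. u *\<^sub>R v1 p + (1 - u) *\<^sub>R v2 p)
      (\<lambda>p k. u *\<^sub>R tau1 p k + (1 - u) *\<^sub>R tau2 p k) (\<lambda>p k. u *\<^sub>R vt1 p k + (1 - u) *\<^sub>R vt2 p k)"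
    unfolding sol_iff by blast
  then show "u *\<^sub>R x1 + u' *\<^sub>R x2 \<in> {x. feasible x}"
    unfolding mpcG_feasible_def u' by blast
qed

end

locale tube_mpc = tube_mpc_data +
  assumes horizons: "1 \<le> Nr" "Nr \<le> Np"
    and Pm_nn: "\<forall>i\<in>{1..np}. nonneg_mat (Pm i)"
    and Pm_eq: "\<forall>i\<in>{1..np}. Pm i ** T = T ** (A i + B i ** Kpred)"
    and Px_nn: "nonneg_mat Px" and Px_eq: "Px ** T = F"
    and Pu_nn: "nonneg_mat Pu" and Pu_eq: "Pu ** T = G ** Kpred"
begin

(* Past Np the tube policy is the terminal feedback Kpred z, i.e. the input offset is 0. *)
definition tail_input
  where "tail_input w k = (if k < Np then w k else 0)"

lemma tube_feasible_step:
  assumes "tube_feasible zN t w" "Nr \<le> k" "k \<le> Np"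
  shows "\<forall>i\<in>{1..np}. \<forall>l\<in>{1..nw}.
           Pm i *v t k + T *v (B i *v tail_input w k) + T *v wv l \<le> t (min (Suc k) Np)"
    and "Px *v t k \<le> 1" and "G *v tail_input w k + Pu *v t k \<le> 1"
  using assms by (cases "k < Np"; auto simp: tube_feasible_def tail_input_def min_def)+

lemma tube_closed_loop_le:
  assumes "i \<in> {1..np}" "T *v y \<le> t"
  shows "T *v ((A i + B i ** Kpred) *v y) \<le> Pm i *v t"
  using nonneg_mat_factor_le[of "Pm i" T "T ** (A i + B i ** Kpred)" y t] assms Pm_nn Pm_eq
  by (simp add: matrix_vector_mul_assoc)

lemma tube_feasible_leaf_node:
  assumes "tube_feasible zN t w"
  shows "F *v zN \<le> 1" and "G *v (tail_input w Nr + Kpred *v zN) \<le> 1"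
proof -
  have tube: "T *v zN \<le> t Nr"
    using assms by (simp add: tube_feasible_def)
  have "F *v zN \<le> Px *v t Nr"
    using nonneg_mat_factor_le[OF Px_nn Px_eq tube] .
  also have "\<dots> \<le> 1"
    using tube_feasible_step(2)[OF assms] horizons by simp
  finally show "F *v zN \<le> 1" .
  have "G *v (tail_input w Nr + Kpred *v zN) = G *v tail_input w Nr + (G ** Kpred) *v zN"
    by (simp add: matrix_vector_right_distrib matrix_vector_mul_assoc)
  also have "\<dots> \<le> G *v tail_input w Nr + Pu *v t Nr"
    using nonneg_mat_factor_le[OF Pu_nn Pu_eq tube] by (rule add_left_mono)
  also have "\<dots> \<le> 1"
    using tube_feasible_step(3)[OF assms] horizons by simp
  finally show "G *v (tail_input w Nr + Kpred *v zN) \<le> 1" .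
qed

lemma tube_feasible_shift:
  assumes "tube_feasible zN t w" "i \<in> {1..np}" "l \<in> {1..nw}"
  shows "tube_feasible (A i *v zN + B i *v (tail_input w Nr + Kpred *v zN) + wv l)
           (\<lambda>k. t (min (Suc k) Np)) (\<lambda>k. tail_input w (Suc k))"
proof -
  have "T *v (A i *v zN + B i *v (tail_input w Nr + Kpred *v zN) + wv l)
      = T *v ((A i + B i ** Kpred) *v zN) + T *v (B i *v tail_input w Nr) + T *v wv l"
    by (simp add: matrix_vector_right_distrib matrix_vector_mult_add_rdistrib matrix_vector_mul_assoc
                  algebra_simps)
  also have "\<dots> \<le> Pm i *v t Nr + T *v (B i *v tail_input w Nr) + T *v wv l"
    using tube_closed_loop_le[OF assms(2)] assms(1) by (simp add: tube_feasible_def)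
  also have "\<dots> \<le> t (min (Suc Nr) Np)"
    using tube_feasible_step(1)[OF assms(1)] assms(2,3) horizons by simp
  finally show ?thesis
    using tube_feasible_step[OF assms(1)] assms(1)
    by (auto simp: tube_feasible_def min_absorb1)
qed

(* Candidate solution at a successor reached through the root branch e: the subtree below e,
   moved up one stage. Its new leaves are reached with the old tube policy, and its tubes are
   the old ones shifted by one stage, the terminal tube at Np being repeated. *)
definition shifted_inputs
  where "shifted_inputs e z v vt p =
    (if Suc (length p) < Nr then v (e # p) else tail_input (vt (e # p)) Nr + Kpred *v z (e # p))"

definition shifted_nodes
  where "shifted_nodes e z v vt p =
    (if length p < Nr then z (e # p)
     else A (fst (last p)) *v z (e # butlast p) + B (fst (last p)) *v shifted_inputs e z v vt (butlast p)
          + wv (snd (last p)))"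

definition shifted_tubes
  where "shifted_tubes e tau p = (\<lambda>k. tau (e # butlast p) (min (Suc k) Np))"

definition shifted_tube_inputs
  where "shifted_tube_inputs e vt p = (\<lambda>k. tail_input (vt (e # butlast p)) (Suc k))"

lemma Cons_mem_scen_paths:
  assumes "p \<in> scen_paths np nw k" "e \<in> {1..np} \<times> {1..nw}"
  shows "e # p \<in> scen_paths np nw (Suc k)"
  using assms by (auto simp: scen_paths_def)

lemma shifted_tree_feasible:
  assumes tree: "tree_feasible z v"
    and leaves: "\<forall>q\<in>scen_paths np nw Nr. tube_feasible (z q) (tau q) (vt q)"
    and e: "e \<in> {1..np} \<times> {1..nw}"
  shows "tree_feasible (shifted_nodes e z v vt) (shifted_inputs e z v vt)"
  unfolding tree_feasible_def
proof (intro allI impI ballI)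
  fix k p assume k: "k < Nr" and p: "p \<in> scen_paths np nw k"
  have ep: "e # p \<in> scen_paths np nw (Suc k)"
    using Cons_mem_scen_paths[OF p e] .
  have len: "length p = k"
    using p by (simp add: scen_paths_def)
  show "F *v shifted_nodes e z v vt p \<le> 1 \<and> G *v shifted_inputs e z v vt p \<le> 1 \<and>
      (\<forall>i\<in>{1..np}. \<forall>l\<in>{1..nw}. shifted_nodes e z v vt (p @ [(i, l)])
         = A i *v shifted_nodes e z v vt p + B i *v shifted_inputs e z v vt p + wv l)"
  proof (cases "Suc k < Nr")
    case True
    then have "F *v z (e # p) \<le> 1 \<and> G *v v (e # p) \<le> 1 \<and>
        (\<forall>i\<in>{1..np}. \<forall>l\<in>{1..nw}.
           z ((e # p) @ [(i,l)]) = A i *v z (e # p) + B i *v v (e # p) + wv l)"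
      using tree ep unfolding tree_feasible_def by blast
    then show ?thesis
      using True k len by (simp add: shifted_nodes_def shifted_inputs_def)
  next
    case False
    then have "Suc k = Nr"
      using k by simp
    then have "tube_feasible (z (e # p)) (tau (e # p)) (vt (e # p))"
      using leaves ep by blast
    then show ?thesis
      using tube_feasible_leaf_node False k len
      by (auto simp: shifted_nodes_def shifted_inputs_def)
  qed
qed

lemma shifted_tube_feasible:
  assumes leaves: "\<forall>q\<in>scen_paths np nw Nr. tube_feasible (z q) (tau q) (vt q)"
    and e: "e \<in> {1..np} \<times> {1..nw}" and p: "p \<in> scen_paths np nw Nr"
  shows "tube_feasible (shifted_nodes e z v vt p) (shifted_tubes e tau p) (shifted_tube_inputs e vt p)"
proof -
  obtain i l where last: "last p = (i, l)"
    by fastforce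
  have "p \<noteq> []" and len: "length p = Nr"
    using p horizons by (auto simp: scen_paths_def)
  then have il: "i \<in> {1..np}" "l \<in> {1..nw}"
    using p last last_in_set[of p] by (auto simp: scen_paths_def)
  have "butlast p \<in> scen_paths np nw (Nr - 1)"
    using p by (auto simp: scen_paths_def dest: in_set_butlastD)
  then have "e # butlast p \<in> scen_paths np nw Nr"
    using Cons_mem_scen_paths[OF _ e] horizons by fastforce
  then have "tube_feasible (z (e # butlast p)) (tau (e # butlast p)) (vt (e # butlast p))"
    using leaves by blast
  from tube_feasible_shift[OF this il]
  show ?thesis
    using len horizons last
    by (simp add: shifted_nodes_def shifted_inputs_def shifted_tubes_def shifted_tube_inputs_def)
qed

lemma shifted_root:
  assumes root: "x \<in> msum {z []} S" and tree: "tree_feasible z v"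
    and il: "i \<in> {1..np}" "l \<in> {1..nw}" and w: "w \<in> Wlow"
    and S_inv: "msum ((*v) (A i + B i ** Kinv) ` S) Wlow \<subseteq> S"
  shows "A i *v x + B i *v (v [] + Kinv *v (x - z [])) + wv l + w
           \<in> msum {shifted_nodes (i, l) z v vt []} S"
proof -
  obtain s where s: "s \<in> S" "x = z [] + s"
    using root by (auto simp: msum_def)
  have "[] \<in> scen_paths np nw 0" and "0 < Nr"
    using horizons by (simp_all add: scen_paths_def)
  then have "z ([] @ [(i, l)]) = A i *v z [] + B i *v v [] + wv l"
    using tree il unfolding tree_feasible_def by blast
  then have "shifted_nodes (i, l) z v vt [] = A i *v z [] + B i *v v [] + wv l"
    using horizons by (simp add: shifted_nodes_def)
  moreover have "(A i + B i ** Kinv) *v s + w \<in> S"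
    using S_inv s w by (auto simp: msum_def)
  moreover have "A i *v x + B i *v (v [] + Kinv *v (x - z [])) + wv l + w
      = (A i *v z [] + B i *v v [] + wv l) + ((A i + B i ** Kinv) *v s + w)"
    using s by (simp add: algebra_simps matrix_vector_mul_assoc matrix_vector_mult_add_rdistrib)
  ultimately show ?thesis
    by (auto simp: msum_def)
qed

lemma shifted_solution_feasible:
  assumes sol: "is_solution x z v tau vt" and Zf: "y \<in> Zf"
    and il: "i \<in> {1..np}" "l \<in> {1..nw}" and w: "w \<in> Wlow"
    and S_inv: "msum ((*v) (A i + B i ** Kinv) ` S) Wlow \<subseteq> S"
  shows "feasible (A i *v x + B i *v (v [] + Kinv *v (x - z [])) + wv l + w)"
proof -
  have "is_solution (A i *v x + B i *v (v [] + Kinv *v (x - z [])) + wv l + w)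
      (shifted_nodes (i, l) z v vt) (shifted_inputs (i, l) z v vt)
      (shifted_tubes (i, l) tau) (shifted_tube_inputs (i, l) vt)"
    using sol shifted_root[OF _ _ il w S_inv] shifted_tree_feasible shifted_tube_feasible il
    unfolding is_solution_iff[OF Zf] by blast
  then show ?thesis
    unfolding mpcG_feasible_def by blast
qed

end

theorem corollary1:
  fixes np nw Nr Np :: nat
    and A :: "nat \<Rightarrow> real^'n^'n" and B :: "nat \<Rightarrow> real^'m^'n"
    and wv :: "nat \<Rightarrow> real^'n"
    and W Wbar Wlow X S Zf :: "(real^'n) set" and U :: "(real^'m) set"
    and Kinv Kpred :: "real^'n^'m"
    and T :: "real^'n^'q" and F :: "real^'n^'f" and G :: "real^'m^'g"
    and Q :: "real^'n^'r" and R :: "real^'m^'s"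
    and Pm :: "nat \<Rightarrow> real^'q^'q" and Px :: "real^'q^'f" and Pu :: "real^'q^'g"
    and PQ :: "real^'q^'r"
    and lam :: real
    and x :: "real^'n"
    and z :: "(nat \<times> nat) list \<Rightarrow> real^'n" and v :: "(nat \<times> nat) list \<Rightarrow> real^'m"
    and tau :: "(nat \<times> nat) list \<Rightarrow> nat \<Rightarrow> real^'q"
    and vt :: "(nat \<times> nat) list \<Rightarrow> nat \<Rightarrow> real^'m"
  assumes np: "1 \<le> np" and nw: "1 \<le> nw" and horizons: "1 \<le> Nr" "Nr \<le> Np"
    \<comment> \<open>disturbance set and its splitting\<close>
    and W_polytope: "polytope W" and W_interior: "0 \<in> interior W"
    and W_split: "W \<subseteq> msum Wbar Wlow"
    and Wbar_def: "Wbar = convex hull (wv ` {1..nw})"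
    \<comment> \<open>polytopic constraint sets and tightened sets\<close>
    and X_polytope: "polytope X" and U_polytope: "polytope U"
    and Z_eq: "{zz. F *v zz \<le> 1} = pdiff X S"
    and V_eq: "{vv. G *v vv \<le> 1} = pdiff U ((*v) Kinv ` S)"
    \<comment> \<open>(A2)\<close>
    and S_polytope: "polytope S" and S_convex: "convex S" and S_compact: "compact S"
    and S_inv: "\<forall>i\<in>{1..np}. msum ((*v) (A i + B i ** Kinv) ` S) Wlow \<subseteq> S"
    and S_X: "S \<subseteq> X" and S_U: "(*v) Kinv ` S \<subseteq> U"
    and S_zero: "Wlow = {0} \<Longrightarrow> S = {0}"
    \<comment> \<open>(A3)\<close>
    and Zf_polytope: "polytope Zf" and Zf_sub: "Zf \<subseteq> pdiff X S" and Zf_0: "0 \<in> Zf"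
    and Zf_rpi: "\<forall>i\<in>{1..np}. msum ((*v) (A i + B i ** Kpred) ` Zf) Wbar \<subseteq> Zf"
    and Zf_input: "(*v) Kpred ` Zf \<subseteq> pdiff U ((*v) Kinv ` S)"
    and Zf_tubes: "\<forall>t. tube T t \<subseteq> Zf \<longrightarrow>
                     (\<exists>t'. (\<forall>i\<in>{1..np}. msum ((*v) (A i + B i ** Kpred) ` tube T t) Wbar \<subseteq> tube T t')
                          \<and> tube T t' \<subseteq> Zf)"
    \<comment> \<open>lambda-contractive tube shape\<close>
    and lam: "0 \<le> lam" "lam < 1"
    and T_contr: "\<forall>i\<in>{1..np}. (*v) (A i + B i ** Kpred) ` tube T 1 \<subseteq> (\<lambda>y. lam *\<^sub>R y) ` tube T 1"
    \<comment> \<open>offline Farkas matrices\<close>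
    and Pm_nn: "\<forall>i\<in>{1..np}. nonneg_mat (Pm i)"
    and Pm_eq: "\<forall>i\<in>{1..np}. Pm i ** T = T ** (A i + B i ** Kpred)"
    and Px_nn: "nonneg_mat Px" and Px_eq: "Px ** T = F"
    and Pu_nn: "nonneg_mat Pu" and Pu_eq: "Pu ** T = G ** Kpred"
    and PQ_nn: "nonneg_mat PQ" and PQ_eq: "PQ ** T = Q"
    \<comment> \<open>feasible solution of P^G_Np(x)\<close>
    and sol: "mpcG_solution np nw A B wv Nr Np T F G S Pm Px Pu PQ Q R Zf x z v tau vt"
  shows "\<forall>xp \<in> msum (convex hull {A i *v x + B i *v (v [] + Kinv *v (x - z [])) | i. i \<in> {1..np}}) W.
           mpcG_feasible np nw A B wv Nr Np T F G S Pm Px Pu PQ Q R Zf xp"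
proof -
  interpret tube_mpc np nw A B wv Nr Np T F G S Pm Px Pu PQ Q R Zf Kpred
    using horizons Pm_nn Pm_eq Px_nn Px_eq Pu_nn Pu_eq by unfold_locales
  define P where "P = {A i *v x + B i *v (v [] + Kinv *v (x - z [])) | i. i \<in> {1..np}}"
  have successors: "P + (wv ` {1..nw} + {w}) \<subseteq> {x. feasible x}" if "w \<in> Wlow" for w
    using shifted_solution_feasible[OF sol Zf_0 _ _ that] S_inv
    by (auto simp: P_def set_plus_def add.assoc)
  have "convex hull (P + (wv ` {1..nw} + {w})) \<subseteq> {x. feasible x}" if "w \<in> Wlow" for w
    using successors[OF that] convex_feasible_set[OF S_convex Zf_0] by (rule hull_minimal)
  moreover have "convex hull (P + (wv ` {1..nw} + {w})) = convex hull P + (Wbar + {w})" for w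
    by (simp add: Wbar_def convex_hull_set_plus)
  moreover have "msum (convex hull P) W \<subseteq> (\<Union>w\<in>Wlow. convex hull P + (Wbar + {w}))"
    using W_split by (fastforce simp: msum_eq_set_plus set_plus_def add.assoc)
  ultimately show ?thesis
    unfolding P_def[symmetric] by blast
qed

end
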